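(* Let $\mu>0$, $-\mu^2/8<a<\mu^2$, $P\in(0,\infty]$, and let $\varphi:\mathbb{R}\to\mathbb{R}$ be a $P$-periodic solution of $$-\mu\varphi+\tfrac12\varphi^2+\tfrac32L(\varphi^2)=a$$ with $\varphi\le\mu$, which is even, non-constant, and non-decreasing on $(-P/2,0)$, and satisfies $\varphi(0)=\mu$. Then: (i) $\varphi$ is smooth on $(-P,0)$. (ii) $\varphi\in C^{0,1}(\mathbb{R})$, i.e. $\varphi$ is Lipschitz continuous on $\mathbb{R}$. (iii) $\varphi$ is exactly Lipschitz at $x=0$; that is, there exist constants $0<c_1<c_2$ such that $$c_1|x|\le|\mu-\varphi(x)|\le c_2|x|$$ for all sufficiently small $|x|$.
   Context: $L=(1-\partial_x^2)^{-1}$ is the operator $Lf=K*f$ on $\mathbb{R}$ with $K(x)=\frac12 e^{-|x|}$. A solution (with wave speed $\mu$) is a bounded measurable function $\varphi:\mathbb{R}\to\mathbb{R}$ satisfying the displayed equation at every point of $\mathbb{R}$. If $P=\infty$, "$P$-periodic" is no condition, and $(-P/2,0)$ and $(-P,0)$ both mean $(-\infty,0)$. *)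

theory Defs
  imports "HOL-Analysis.Analysis"
begin

definition kernel_K :: "real \<Rightarrow> real" where
  "kernel_K x = exp (- \<bar>x\<bar>) / 2"

text \<open>The operator \<open>L = (1 - \<partial>\<^sub>x\<^sup>2)\<inverse>\<close>, i.e. convolution with the kernel \<open>K\<close>. For bounded measurable
  \<open>f\<close> the integrand is always Lebesgue integrable, so the convention that a non-integrable
  function has integral \<open>0\<close> plays no role.\<close>

definition op_L :: "(real \<Rightarrow> real) \<Rightarrow> real \<Rightarrow> real" where
  "op_L f x = (\<integral>y. kernel_K (x - y) * f y \<partial>lebesgue)"

definition is_solution :: "real \<Rightarrow> real \<Rightarrow> (real \<Rightarrow> real) \<Rightarrow> bool" where
  "is_solution \<mu> a \<phi> \<longleftrightarrow>
     \<phi> \<in> borel_measurable lebesgue \<and> bounded (range \<phi>) \<and>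
     (\<forall>x. - \<mu> * \<phi> x + 1/2 * (\<phi> x)\<^sup>2 + 3/2 * op_L (\<lambda>y. (\<phi> y)\<^sup>2) x = a)"

text \<open>The period lives in the extended reals; \<open>P = \<infinity>\<close> imposes no condition.\<close>

definition periodic_ext :: "ereal \<Rightarrow> (real \<Rightarrow> real) \<Rightarrow> bool" where
  "periodic_ext P \<phi> \<longleftrightarrow> (\<forall>p. P = ereal p \<longrightarrow> (\<forall>x. \<phi> (x + p) = \<phi> x))"

text \<open>\<open>C\<^sup>\<infinity>\<close> regularity, meant for open \<open>S\<close>: derivatives of every order exist at each point of \<open>S\<close>
  (and hence are continuous there).\<close>

definition smooth_on_open :: "real set \<Rightarrow> (real \<Rightarrow> real) \<Rightarrow> bool" where
  "smooth_on_open S f \<longleftrightarrow> (\<forall>n. \<forall>x\<in>S. ((deriv ^^ n) f) field_differentiable (at x))"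

end

theory Submission
  imports Defs
begin

text \<open>Completing the square in the equation gives, for \<open>u = \<mu> - \<phi> \<ge> 0\<close> and \<open>w = L(\<phi>\<^sup>2)\<close>,
  \<open>u\<^sup>2 = \<mu>\<^sup>2 + 2a - 3w\<close>. Convolution with \<open>K\<close> makes \<open>w\<close> continuous although \<open>\<phi>\<close> is only measurable,
  so \<open>\<phi> = \<mu> - sqrt (\<mu>\<^sup>2 + 2a - 3w)\<close> is continuous; then \<open>w\<close> is twice differentiable with
  \<open>w'' = w - \<phi>\<^sup>2\<close>. Eliminating \<open>w\<close>, the nonlocal equation turns into a local one for \<open>g = u\<^sup>2\<close>, valid
  on the whole line and in particular across the crest:
  \<open>g'' = 4 u\<^sup>2 - 6 \<mu> u + 2 (\<mu>\<^sup>2 - a)\<close>  (\<open>crested_profile_of_solution\<close>).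

  The right-hand side is bounded, and a nonnegative function with second derivative at most \<open>M\<close> has
  a Lipschitz square root (\<open>nonneg_second_deriv_bound\<close>); hence \<open>u\<close>, and with it \<open>\<phi>\<close>, is Lipschitz.
  At the crest \<open>g\<close> and \<open>g'\<close> vanish while \<open>g'' 0 = 2 (\<mu>\<^sup>2 - a) > 0\<close>, so \<open>u\<^sup>2\<close> grows at least
  quadratically and \<open>u\<close> at least linearly.

  This linear growth also forbids \<open>\<phi> = \<mu>\<close> strictly between consecutive crests: by monotonicity
  \<open>\<phi>\<close> would equal \<open>\<mu>\<close> from there up to \<open>0\<close>. Where \<open>u > 0\<close>, multiplying the equation for \<open>g\<close> by
  \<open>g'\<close> and integrating from the crest gives \<open>g'\<^sup>2 = 4 u\<^sup>2 ((u - \<mu>)\<^sup>2 - a)\<close>. Since \<open>u' = g' / (2u)\<close>,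
  differentiating once more and inserting this identity leaves \<open>u'' = u - \<mu>\<close>, that is
  \<open>\<phi>'' = \<phi>\<close>. Smoothness between the crests is then immediate.\<close>

section \<open>Convolution with the kernel\<close>

lemma kernel_K_shift_le: "kernel_K (z - y) \<le> exp \<bar>z - x\<bar> * kernel_K (x - y)"
  unfolding kernel_K_def by (simp flip: exp_add)

text \<open>A translate of the kernel differs from the kernel by a small multiple of the kernel itself.
  Continuity of the convolution follows from this without any regularity of the other factor.\<close>

lemma kernel_K_shift_diff_le:
  "\<bar>kernel_K (z - y) - kernel_K (x - y)\<bar> \<le> (exp \<bar>z - x\<bar> - 1) * kernel_K (x - y)"
proof -
  define d where "d = exp \<bar>z - x\<bar>"
  have d: "d \<ge> 1" "kernel_K (z - y) \<le> d * kernel_K (x - y)" "kernel_K (x - y) \<le> d * kernel_K (z - y)"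
    using kernel_K_shift_le[of z y x] kernel_K_shift_le[of x y z] by (auto simp: d_def abs_minus_commute)
  have "(d - 1) * kernel_K (z - y) \<le> (d - 1) * (d * kernel_K (x - y))"
    using d by (intro mult_left_mono) auto
  moreover have "kernel_K (x - y) - kernel_K (z - y) \<le> (d - 1) * kernel_K (x - y)"
  proof (cases "kernel_K (z - y) \<le> kernel_K (x - y)")
    case True
    then have "(d - 1) * kernel_K (z - y) \<le> (d - 1) * kernel_K (x - y)"
      using d by (intro mult_left_mono) auto
    then show ?thesis using d by (simp add: algebra_simps)
  next
    case False
    moreover have "0 \<le> (d - 1) * kernel_K (x - y)"
      using d by (simp add: kernel_K_def)
    ultimately show ?thesis by linarith
  qed
  ultimately show ?thesis
    using d unfolding d_def[symmetric] by (simp add: abs_le_iff algebra_simps)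
qed

lemma kernel_K_measurable [measurable]: "(\<lambda>y. kernel_K (x - y)) \<in> borel_measurable borel"
  unfolding kernel_K_def by measurable

lemma integrable_kernel_K_shift: "integrable lebesgue (\<lambda>y. kernel_K (x - y))"
proof -
  \<comment> \<open>Integrability of the centred kernel suffices, since every translate is at most a multiple of it.\<close>
  have "(\<lambda>y::real. exp (- 1 * y) / 2) integrable_on {0..}"
    by (intro integrable_on_divide integrable_on_exp_minus_to_infinity) auto
  then have "kernel_K integrable_on {0..}"
    by (rule integrable_eq) (simp add: kernel_K_def)
  then have right: "kernel_K absolutely_integrable_on {0..}"
    by (intro nonnegative_absolutely_integrable_1) (auto simp: kernel_K_def)
  have "(\<lambda>y. kernel_K (- y)) absolutely_integrable_on {..0}"
    using has_absolute_integral_reflect_real[of "{..0}" "{0..}" kernel_K] right by auto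
  moreover have "kernel_K (- y) = kernel_K y" for y
    by (simp add: kernel_K_def)
  ultimately have left: "kernel_K absolutely_integrable_on {..0}"
    by simp
  have "kernel_K absolutely_integrable_on {..0} \<union> {0..}"
    using left right by (intro set_integrable_Un) auto
  moreover have "{..0} \<union> {0..} = (UNIV :: real set)" by auto
  ultimately have "integrable lebesgue kernel_K"
    by (simp add: set_integrable_def)
  then have "integrable lebesgue (\<lambda>y. exp \<bar>x\<bar> * kernel_K y)"
    by simp
  then show ?thesis
  proof (rule Bochner_Integration.integrable_bound)
    show "(\<lambda>y. kernel_K (x - y)) \<in> borel_measurable lebesgue"
      by (intro measurable_completion) simp
    have "norm (kernel_K (x - y)) \<le> norm (exp \<bar>x\<bar> * kernel_K y)" for y
      using kernel_K_shift_le[of x y 0] by (simp add: kernel_K_def)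
    then show "AE y in lebesgue. norm (kernel_K (x - y)) \<le> norm (exp \<bar>x\<bar> * kernel_K y)"
      by simp
  qed
qed

lemma integrable_kernel_K_mult:
  assumes "f \<in> borel_measurable lebesgue" "bounded (range f)"
  shows "integrable lebesgue (\<lambda>y. kernel_K (x - y) * f y)"
proof -
  obtain B where B: "\<And>y. \<bar>f y\<bar> \<le> B"
    using assms(2) by (auto simp: bounded_iff)
  have "integrable lebesgue (\<lambda>y. B * kernel_K (x - y))"
    using integrable_kernel_K_shift by simp
  then show ?thesis
  proof (rule Bochner_Integration.integrable_bound)
    show "(\<lambda>y. kernel_K (x - y) * f y) \<in> borel_measurable lebesgue"
      using assms(1) borel_measurable_integrable[OF integrable_kernel_K_shift] by (intro borel_measurable_times)
    have "norm (kernel_K (x - y) * f y) \<le> norm (B * kernel_K (x - y))" for y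
      using B[of y] by (auto simp: kernel_K_def abs_mult intro!: mult_right_mono divide_right_mono)
    then show "AE y in lebesgue. norm (kernel_K (x - y) * f y) \<le> norm (B * kernel_K (x - y))"
      by simp
  qed
qed

lemma continuous_op_L:
  assumes "f \<in> borel_measurable lebesgue" "bounded (range f)"
  shows "continuous_on UNIV (op_L f)"
proof -
  obtain B where B: "\<And>y. \<bar>f y\<bar> \<le> B"
    using assms(2) by (auto simp: bounded_iff)
  have "isCont (op_L f) x" for x
  proof -
    define J where "J = (\<integral>y. kernel_K (x - y) \<partial>lebesgue)"
    have bound: "\<bar>op_L f z - op_L f x\<bar> \<le> (exp \<bar>z - x\<bar> - 1) * B * J" for z
    proof -
      have int: "integrable lebesgue (\<lambda>y. (kernel_K (z - y) - kernel_K (x - y)) * f y)"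
        using Bochner_Integration.integrable_diff[OF integrable_kernel_K_mult[OF assms, of z] integrable_kernel_K_mult[OF assms, of x]]
        by (simp add: algebra_simps)
      have "op_L f z - op_L f x = (\<integral>y. (kernel_K (z - y) - kernel_K (x - y)) * f y \<partial>lebesgue)"
        unfolding op_L_def using integrable_kernel_K_mult[OF assms]
        by (subst Bochner_Integration.integral_diff[symmetric]) (auto simp: algebra_simps)
      also have "\<bar>\<dots>\<bar> \<le> (\<integral>y. (exp \<bar>z - x\<bar> - 1) * B * kernel_K (x - y) \<partial>lebesgue)"
      proof (rule order_trans[OF integral_abs_bound integral_mono])
        show "integrable lebesgue (\<lambda>y. \<bar>(kernel_K (z - y) - kernel_K (x - y)) * f y\<bar>)"
          using int by (rule integrable_abs)
        show "integrable lebesgue (\<lambda>y. (exp \<bar>z - x\<bar> - 1) * B * kernel_K (x - y))"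
          using integrable_kernel_K_shift by simp
        fix y
        have "\<bar>kernel_K (z - y) - kernel_K (x - y)\<bar> * \<bar>f y\<bar> \<le> ((exp \<bar>z - x\<bar> - 1) * kernel_K (x - y)) * B"
          using kernel_K_shift_diff_le[of z y x] B[of y]
          by (intro mult_mono) (auto simp: kernel_K_def)
        then show "\<bar>(kernel_K (z - y) - kernel_K (x - y)) * f y\<bar> \<le> (exp \<bar>z - x\<bar> - 1) * B * kernel_K (x - y)"
          by (simp add: abs_mult mult_ac)
      qed
      finally show ?thesis by (simp add: J_def)
    qed
    have "((\<lambda>z. (exp \<bar>z - x\<bar> - 1) * B * J) \<longlongrightarrow> (exp \<bar>x - x\<bar> - 1) * B * J) (at x)"
      by (intro tendsto_intros)
    then have "((\<lambda>z. (exp \<bar>z - x\<bar> - 1) * B * J) \<longlongrightarrow> 0) (at x)" by simp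
    then have "((\<lambda>z. op_L f z - op_L f x) \<longlongrightarrow> 0) (at x)"
      by (rule Lim_null_comparison[rotated]) (use bound in auto)
    then show ?thesis
      unfolding isCont_def using LIM_zero_cancel by blast
  qed
  then show ?thesis
    by (simp add: continuous_at_imp_continuous_on)
qed

lemma integral_atMost_has_real_derivative:
  fixes h :: "real \<Rightarrow> real"
  assumes cont: "continuous_on UNIV h" and int: "\<And>x. h integrable_on {..x}"
  shows "((\<lambda>x. integral {..x} h) has_real_derivative h x) (at x)"
proof -
  have "((\<lambda>t. integral {x - 1..t} h) has_real_derivative h x) (at x within {x - 1..x + 1})"
    by (rule integral_has_real_derivative) (auto intro: continuous_on_subset[OF cont])
  then have "((\<lambda>t. integral {x - 1..t} h) has_real_derivative h x) (at x)"
    by (simp add: at_within_Icc_at)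
  then have "((\<lambda>t. integral {..x - 1} h + integral {x - 1..t} h) has_real_derivative h x) (at x)"
    by (auto intro!: derivative_eq_intros)
  then show ?thesis
  proof (rule DERIV_cong_ev[THEN iffD1, rotated -1])
    have "\<forall>\<^sub>F t in nhds x. x - 1 < t"
      using eventually_nhds_in_open[of "{x - 1<..}" x] by simp
    then show "\<forall>\<^sub>F t in nhds x. integral {..x - 1} h + integral {x - 1..t} h = integral {..t} h"
    proof eventually_elim
      case (elim t)
      have "integral ({..x - 1} \<union> {x - 1..t}) h = integral {..x - 1} h + integral {x - 1..t} h"
        using int elim
        by (intro integral_Un) (auto intro!: integrable_continuous_interval continuous_on_subset[OF cont]
            negligible_subset[of "{x - 1}"])
      moreover have "{..x - 1} \<union> {x - 1..t} = {..t}" using elim by auto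
      ultimately show ?case by simp
    qed
  qed auto
qed

lemma integral_atLeast_has_real_derivative:
  fixes h :: "real \<Rightarrow> real"
  assumes cont: "continuous_on UNIV h" and int: "\<And>x. h integrable_on {x..}"
  shows "((\<lambda>x. integral {x..} h) has_real_derivative - h x) (at x)"
proof -
  have "((\<lambda>t. integral {t..x + 1} h) has_real_derivative - h x) (at x within {x - 1..x + 1})"
    by (rule integral_has_real_derivative') (auto intro: continuous_on_subset[OF cont])
  then have "((\<lambda>t. integral {t..x + 1} h) has_real_derivative - h x) (at x)"
    by (simp add: at_within_Icc_at)
  then have "((\<lambda>t. integral {t..x + 1} h + integral {x + 1..} h) has_real_derivative - h x) (at x)"
    by (auto intro!: derivative_eq_intros)
  then show ?thesis
  proof (rule DERIV_cong_ev[THEN iffD1, rotated -1])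
    have "\<forall>\<^sub>F t in nhds x. t < x + 1"
      using eventually_nhds_in_open[of "{..<x + 1}" x] by simp
    then show "\<forall>\<^sub>F t in nhds x. integral {t..x + 1} h + integral {x + 1..} h = integral {t..} h"
    proof eventually_elim
      case (elim t)
      have "integral ({t..x + 1} \<union> {x + 1..}) h = integral {t..x + 1} h + integral {x + 1..} h"
        using int elim
        by (intro integral_Un) (auto intro!: integrable_continuous_interval continuous_on_subset[OF cont]
            negligible_subset[of "{x + 1}"])
      moreover have "{t..x + 1} \<union> {x + 1..} = {t..}" using elim by auto
      ultimately show ?case by simp
    qed
  qed auto
qed

text \<open>On each side of \<open>x\<close> the kernel factors into a function of \<open>x\<close> times a function of \<open>y\<close>. In this
  form \<open>x\<close> enters only through prefactors and limits of integration, so the fundamental theorem of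
  calculus applies.\<close>

lemma op_L_half_line_split:
  assumes cont: "continuous_on UNIV f" and bdd: "bounded (range f)"
  shows "(\<lambda>y. exp y * f y) integrable_on {..x}"
    and "(\<lambda>y. exp (- y) * f y) integrable_on {x..}"
    and "op_L f x = exp (- x) / 2 * integral {..x} (\<lambda>y. exp y * f y)
                  + exp x / 2 * integral {x..} (\<lambda>y. exp (- y) * f y)"
proof -
  have meas: "f \<in> borel_measurable lebesgue"
    using borel_measurable_continuous_onI[OF cont] by (simp add: measurable_completion)
  have int: "(\<lambda>y. kernel_K (x - y) * f y) absolutely_integrable_on UNIV"
    using integrable_kernel_K_mult[OF meas bdd] by (simp add: set_integrable_def)
  have on: "(\<lambda>y. kernel_K (x - y) * f y) integrable_on S" if "S \<in> sets lebesgue" for S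
    using set_integrable_subset[OF int that] set_lebesgue_integral_eq_integral(1) by blast
  have left: "kernel_K (x - y) * f y = exp (- x) / 2 * (exp y * f y)" if "y \<in> {..x}" for y
    using that by (simp add: kernel_K_def exp_diff exp_minus field_simps)
  have right: "kernel_K (x - y) * f y = exp x / 2 * (exp (- y) * f y)" if "y \<in> {x..}" for y
    using that by (simp add: kernel_K_def exp_diff exp_minus field_simps)
  have "(\<lambda>y. exp (- x) / 2 * (exp y * f y)) integrable_on {..x}"
    by (rule integrable_eq[OF on left]) auto
  then show "(\<lambda>y. exp y * f y) integrable_on {..x}"
    by (subst (asm) integrable_on_cmult_iff) auto
  have "(\<lambda>y. exp x / 2 * (exp (- y) * f y)) integrable_on {x..}"
    by (rule integrable_eq[OF on right]) auto
  then show "(\<lambda>y. exp (- y) * f y) integrable_on {x..}"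
    by (subst (asm) integrable_on_cmult_iff) auto
  have "op_L f x = integral UNIV (\<lambda>y. kernel_K (x - y) * f y)"
    using set_lebesgue_integral_eq_integral(2)[OF int]
    by (simp add: op_L_def set_lebesgue_integral_def)
  also have "\<dots> = integral ({..x} \<union> {x..}) (\<lambda>y. kernel_K (x - y) * f y)"
    by (rule arg_cong[where f = "\<lambda>S. integral S _"]) auto
  also have "\<dots> = integral {..x} (\<lambda>y. kernel_K (x - y) * f y) + integral {x..} (\<lambda>y. kernel_K (x - y) * f y)"
  proof (rule integral_Un)
    show "negligible ({..x} \<inter> {x..})"
      by (rule negligible_subset[of "{x}"]) auto
  qed (rule on, simp)+
  also have "integral {..x} (\<lambda>y. kernel_K (x - y) * f y) = exp (- x) / 2 * integral {..x} (\<lambda>y. exp y * f y)"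
    unfolding Henstock_Kurzweil_Integration.integral_mult_right[symmetric]
    using left by (rule Henstock_Kurzweil_Integration.integral_cong)
  also have "integral {x..} (\<lambda>y. kernel_K (x - y) * f y) = exp x / 2 * integral {x..} (\<lambda>y. exp (- y) * f y)"
    unfolding Henstock_Kurzweil_Integration.integral_mult_right[symmetric]
    using right by (rule Henstock_Kurzweil_Integration.integral_cong)
  finally show "op_L f x = exp (- x) / 2 * integral {..x} (\<lambda>y. exp y * f y)
                  + exp x / 2 * integral {x..} (\<lambda>y. exp (- y) * f y)" .
qed

text \<open>\<open>L\<close> inverts \<open>1 - \<partial>\<^sub>x\<^sup>2\<close>. In \<open>w'\<close> the two boundary terms cancel, as the two halves of the kernel
  agree at \<open>0\<close>; in \<open>w''\<close> they add up to \<open>- f\<close>, the jump of the derivative of the kernel.\<close>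

lemma op_L_second_derivative:
  assumes cont: "continuous_on UNIV f" and bdd: "bounded (range f)"
  obtains w' where "\<And>x. (op_L f has_real_derivative w' x) (at x)"
    and "\<And>x. (w' has_real_derivative op_L f x - f x) (at x)"
proof -
  define A where "A x = integral {..x} (\<lambda>y. exp y * f y)" for x
  define B where "B x = integral {x..} (\<lambda>y. exp (- y) * f y)" for x
  define w' where "w' x = - (exp (- x) / 2 * A x) + exp x / 2 * B x" for x
  note split = op_L_half_line_split[OF assms]
  have L: "op_L f = (\<lambda>x. exp (- x) / 2 * A x + exp x / 2 * B x)"
    using split(3) by (auto simp: A_def B_def)
  have A: "(A has_real_derivative exp x * f x) (at x)" for x
    unfolding A_def using split(1)
    by (intro integral_atMost_has_real_derivative continuous_intros cont) auto
  have B: "(B has_real_derivative - (exp (- x) * f x)) (at x)" for x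
    unfolding B_def using split(2)
    by (intro integral_atLeast_has_real_derivative continuous_intros cont) auto
  show thesis
  proof (rule that)
    fix x
    show "(op_L f has_real_derivative w' x) (at x)"
      unfolding L w'_def
      by (rule derivative_eq_intros A B refl | simp add: exp_minus field_simps)+
    show "(w' has_real_derivative op_L f x - f x) (at x)"
      unfolding L w'_def
      by (rule derivative_eq_intros A B refl | simp add: exp_minus field_simps)+
  qed
qed

section \<open>Nonnegative functions with bounded second derivative\<close>

lemma Taylor_second_order:
  fixes g g' g'' :: "real \<Rightarrow> real"
  assumes "\<And>x. (g has_real_derivative g' x) (at x)" "\<And>x. (g' has_real_derivative g'' x) (at x)"
  obtains t where "\<bar>t - y\<bar> \<le> \<bar>x - y\<bar>"
    "g x = g y + g' y * (x - y) + g'' t / 2 * (x - y)\<^sup>2"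
proof (cases "x = y")
  case False
  \<comment> \<open>The derivatives of \<open>g\<close> indexed by their order, as Taylor's theorem takes them.\<close>
  define D where "D m = (if m = 0 then g else if m = 1 then g' else g'')" for m :: nat
  have "\<exists>t. (if x < y then x < t \<and> t < y else y < t \<and> t < x) \<and>
      g x = (\<Sum>m<2. (D m y / fact m) * (x - y)^m) + (D 2 t / fact 2) * (x - y)^2"
  proof (rule Taylor[where a = "min x y" and b = "max x y"])
    have "(D m has_real_derivative D (Suc m) t) (at t)" if "m < 2" for m t
      using that assms by (cases m) (auto simp: D_def)
    then show "\<forall>m t. m < 2 \<and> min x y \<le> t \<and> t \<le> max x y \<longrightarrow> (D m has_real_derivative D (Suc m) t) (at t)"
      by blast
  qed (use False in \<open>auto simp: D_def\<close>)
  then obtain t where "if x < y then x < t \<and> t < y else y < t \<and> t < x"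
      "g x = g y + g' y * (x - y) + g'' t / 2 * (x - y)\<^sup>2"
    by (auto simp: D_def numeral_2_eq_2)
  then show thesis
    by (intro that[of t]) (auto split: if_splits)
qed (use that[of y] in auto)

text \<open>A nonnegative function with \<open>g'' \<le> M\<close> lies below the parabola with its value and slope at \<open>y\<close>.
  That parabola has to stay nonnegative, so its discriminant is nonpositive, which is the bound on
  \<open>g' y\<close>. Inserting this bound, the parabola is at most \<open>(sqrt (g y) + sqrt (M/2) \<bar>x - y\<bar>)\<^sup>2\<close>, and
  taking roots gives the Lipschitz estimate, also across zeros of \<open>g\<close>.\<close>

lemma nonneg_second_deriv_bound:
  fixes g g' g'' :: "real \<Rightarrow> real"
  assumes g: "\<And>x. (g has_real_derivative g' x) (at x)" and g': "\<And>x. (g' has_real_derivative g'' x) (at x)"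
    and nonneg: "\<And>x. 0 \<le> g x" and M: "M > 0" "\<And>x. g'' x \<le> M"
  shows "(g' y)\<^sup>2 \<le> 2 * M * g y"
    and "(sqrt (M / 2))-lipschitz_on UNIV (\<lambda>x. sqrt (g x))"
proof -
  have taylor: "g x \<le> g y + g' y * (x - y) + M / 2 * (x - y)\<^sup>2" for x y
  proof -
    obtain t where "g x = g y + g' y * (x - y) + g'' t / 2 * (x - y)\<^sup>2"
      using Taylor_second_order[OF g g'] by metis
    moreover have "g'' t / 2 * (x - y)\<^sup>2 \<le> M / 2 * (x - y)\<^sup>2"
      using M(2)[of t] by (intro mult_right_mono) auto
    ultimately show ?thesis by linarith
  qed
  show deriv: "(g' y)\<^sup>2 \<le> 2 * M * g y" for y
  proof -
    \<comment> \<open>The parabola is evaluated at its vertex.\<close>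
    have "0 \<le> g y + g' y * (- g' y / M) + M / 2 * (- g' y / M)\<^sup>2"
      using taylor[of "y - g' y / M" y] nonneg[of "y - g' y / M"] by simp
    then show ?thesis
      using M(1) by (simp add: field_simps power2_eq_square)
  qed
  have upper: "sqrt (g x) \<le> sqrt (g y) + sqrt (M / 2) * \<bar>x - y\<bar>" for x y
  proof (rule real_le_lsqrt)
    have "g' y * (x - y) \<le> \<bar>g' y\<bar> * \<bar>x - y\<bar>"
      by (simp flip: abs_mult)
    also have "\<dots> \<le> sqrt (2 * M * g y) * \<bar>x - y\<bar>"
      using deriv[of y] by (intro mult_right_mono real_le_rsqrt) auto
    also have "sqrt (2 * M * g y) = 2 * sqrt (g y) * sqrt (M / 2)"
      using M(1) nonneg[of y] by (intro real_sqrt_unique) (auto simp: power_mult_distrib)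
    finally have "g x \<le> g y + 2 * sqrt (g y) * sqrt (M / 2) * \<bar>x - y\<bar> + M / 2 * (x - y)\<^sup>2"
      using taylor[of x y] by linarith
    also have "\<dots> = (sqrt (g y) + sqrt (M / 2) * \<bar>x - y\<bar>)\<^sup>2"
      using M(1) nonneg[of y] by (simp add: power2_sum power_mult_distrib)
    finally show "g x \<le> (sqrt (g y) + sqrt (M / 2) * \<bar>x - y\<bar>)\<^sup>2" .
  qed (use M(1) nonneg in auto)
  show "(sqrt (M / 2))-lipschitz_on UNIV (\<lambda>x. sqrt (g x))"
  proof (rule lipschitz_onI)
    fix x y
    show "dist (sqrt (g x)) (sqrt (g y)) \<le> sqrt (M / 2) * dist x y"
      using upper[of x y] upper[of y x] by (simp add: dist_real_def abs_le_iff abs_minus_commute)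
  qed (use M(1) in auto)
qed

section \<open>Smoothness from a linear equation\<close>

lemma smooth_on_open_if_second_deriv_eq_self:
  assumes S: "open S"
    and f: "\<And>x. x \<in> S \<Longrightarrow> (f has_real_derivative f' x) (at x)"
    and f': "\<And>x. x \<in> S \<Longrightarrow> (f' has_real_derivative f x) (at x)"
  shows "smooth_on_open S f"
proof -
  have "\<forall>x\<in>S. (deriv ^^ n) f x = (if even n then f x else f' x)" for n
  proof (induction n)
    case (Suc n)
    show ?case
    proof
      fix x assume x: "x \<in> S"
      have "\<forall>\<^sub>F y in nhds x. (deriv ^^ n) f y = (if even n then f y else f' y)"
        using eventually_nhds_in_open[OF S x] Suc by (auto elim!: eventually_mono)
      then have "deriv ((deriv ^^ n) f) x = deriv (\<lambda>y. if even n then f y else f' y) x"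
        by (rule deriv_cong_ev) simp
      also have "\<dots> = (if even n then f' x else f x)"
        using f[OF x] f'[OF x] by (auto intro: DERIV_imp_deriv)
      finally show "(deriv ^^ Suc n) f x = (if even (Suc n) then f x else f' x)" by simp
    qed
  qed simp
  note iter = this
  show ?thesis
    unfolding smooth_on_open_def
  proof (intro allI ballI)
    fix n :: nat and x assume x: "x \<in> S"
    have "((\<lambda>y. if even n then f y else f' y) has_real_derivative (if even n then f' x else f x)) (at x)"
      using f[OF x] f'[OF x] by auto
    moreover have "\<forall>\<^sub>F y in nhds x. (if even n then f y else f' y) = (deriv ^^ n) f y"
      using eventually_nhds_in_open[OF S x] iter[of n] by (auto elim!: eventually_mono)
    ultimately have "((deriv ^^ n) f has_real_derivative (if even n then f' x else f x)) (at x)"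
      by (rule DERIV_cong_ev[OF refl _ refl, THEN iffD1, rotated])
    then show "(deriv ^^ n) f field_differentiable at x"
      unfolding field_differentiable_def by blast
  qed
qed

section \<open>Wave profiles with a crest at the origin\<close>

text \<open>The local form of the problem: \<open>u\<close> stands for \<open>\<mu> - \<phi>\<close> and \<open>g'\<close> for the derivative of \<open>u\<^sup>2\<close>. The
  equation is stated for \<open>u\<^sup>2\<close> because \<open>u\<close> itself has a corner at the crest.\<close>

locale crested_profile =
  fixes \<mu> a :: real and u g' :: "real \<Rightarrow> real"
  assumes nonneg: "\<And>x. 0 \<le> u x"
    and bdd: "bounded (range u)"
    and deriv_sq: "\<And>x. ((\<lambda>x. (u x)\<^sup>2) has_real_derivative g' x) (at x)"
    and ode: "\<And>x. (g' has_real_derivative 4 * (u x)\<^sup>2 - 6 * \<mu> * u x + 2 * (\<mu>\<^sup>2 - a)) (at x)"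
    and crest: "u 0 = 0"
    and a_less: "a < \<mu>\<^sup>2"
begin

lemma second_deriv_bounded:
  obtains M where "M > 0" "\<And>x. 4 * (u x)\<^sup>2 - 6 * \<mu> * u x + 2 * (\<mu>\<^sup>2 - a) \<le> M"
proof -
  obtain B where B: "\<And>x. \<bar>u x\<bar> \<le> B"
    using bdd by (auto simp: bounded_iff)
  define M where "M = 4 * B\<^sup>2 + 6 * \<bar>\<mu>\<bar> * B + 2 * (\<mu>\<^sup>2 - a)"
  have "4 * (u x)\<^sup>2 - 6 * \<mu> * u x + 2 * (\<mu>\<^sup>2 - a) \<le> M" for x
  proof -
    have "(u x)\<^sup>2 \<le> B\<^sup>2"
      using B[of x] by (rule power2_le_iff_abs_le[THEN iffD2, rotated]) (use B[of x] in auto)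
    moreover have "- (\<mu> * u x) \<le> \<bar>\<mu> * u x\<bar>" by simp
    then have "- (\<mu> * u x) \<le> \<bar>\<mu>\<bar> * B"
      using mult_left_mono[OF B[of x], of "\<bar>\<mu>\<bar>"] by (simp add: abs_mult)
    ultimately show ?thesis by (simp add: M_def)
  qed
  moreover have "0 < M"
    using calculation[of 0] crest a_less by simp
  ultimately show thesis using that by blast
qed

lemma lipschitz: "\<exists>C\<ge>0. C-lipschitz_on UNIV u"
proof -
  obtain M where M: "M > 0" "\<And>x. 4 * (u x)\<^sup>2 - 6 * \<mu> * u x + 2 * (\<mu>\<^sup>2 - a) \<le> M"
    using second_deriv_bounded by blast
  have "(sqrt (M / 2))-lipschitz_on UNIV (\<lambda>x. sqrt ((u x)\<^sup>2))"
    by (rule nonneg_second_deriv_bound(2)[OF deriv_sq ode _ M]) simp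
  then have "(sqrt (M / 2))-lipschitz_on UNIV u"
    using nonneg by simp
  then show ?thesis
    using lipschitz_on_nonneg by blast
qed

lemma continuous: "isCont u x"
  using lipschitz lipschitz_on_continuous_on[of _ UNIV u] by (auto simp: continuous_on_eq_continuous_at)

lemma deriv_sq_zero: "g' 0 = 0"
proof -
  obtain M where M: "M > 0" "\<And>x. 4 * (u x)\<^sup>2 - 6 * \<mu> * u x + 2 * (\<mu>\<^sup>2 - a) \<le> M"
    using second_deriv_bounded by blast
  have "(g' 0)\<^sup>2 \<le> 2 * M * (u 0)\<^sup>2"
    by (rule nonneg_second_deriv_bound(1)[OF deriv_sq ode _ M]) simp
  then show ?thesis by (simp add: crest)
qed

text \<open>Second order Taylor expansion of \<open>u\<^sup>2\<close> at the crest, where its value and slope vanish and its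
  second derivative is \<open>2 (\<mu>\<^sup>2 - a) > 0\<close>.\<close>

lemma linear_lower_bound:
  obtains c where "0 < c" "\<forall>\<^sub>F x in nhds 0. c * \<bar>x\<bar> \<le> u x"
proof -
  define k where "k = \<mu>\<^sup>2 - a"
  define g'' where "g'' x = 4 * (u x)\<^sup>2 - 6 * \<mu> * u x + 2 * (\<mu>\<^sup>2 - a)" for x
  have k: "k > 0" using a_less by (simp add: k_def)
  have "isCont g'' 0"
    unfolding g''_def by (intro continuous_intros continuous)
  then have "(g'' \<longlongrightarrow> g'' 0) (nhds 0)"
    using isCont_def tendsto_at_iff_tendsto_nhds by blast
  moreover have "k < g'' 0" using k by (simp add: g''_def crest k_def)
  ultimately have "\<forall>\<^sub>F x in nhds 0. k < g'' x" by (rule order_tendstoD)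
  then obtain d where d: "d > 0" "\<And>x. \<bar>x\<bar> < d \<Longrightarrow> k < g'' x"
    by (auto simp: eventually_nhds_metric)
  have "sqrt (k / 2) * \<bar>x\<bar> \<le> u x" if "\<bar>x\<bar> < d" for x
  proof -
    obtain t where t: "\<bar>t\<bar> \<le> \<bar>x\<bar>" "(u x)\<^sup>2 = g'' t / 2 * x\<^sup>2"
      using Taylor_second_order[OF deriv_sq ode, of 0 x] deriv_sq_zero crest
      by (auto simp: g''_def)
    have "k / 2 * x\<^sup>2 \<le> (u x)\<^sup>2"
      unfolding t(2) using d(2)[of t] t(1) that by (intro mult_right_mono) auto
    then have "sqrt (k / 2 * x\<^sup>2) \<le> u x"
      using k nonneg by (intro real_le_lsqrt) auto
    also have "sqrt (k / 2 * x\<^sup>2) = sqrt (k / 2) * \<bar>x\<bar>"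
      by (simp only: real_sqrt_mult real_sqrt_abs)
    finally show ?thesis .
  qed
  then have "\<forall>\<^sub>F x in nhds 0. sqrt (k / 2) * \<bar>x\<bar> \<le> u x"
    using d(1) by (auto simp: eventually_nhds_metric)
  then show thesis using that[of "sqrt (k / 2)"] k by simp
qed

lemma exactly_lipschitz_at_crest:
  "\<exists>c1 c2. 0 < c1 \<and> c1 < c2 \<and> (\<forall>\<^sub>F x in nhds 0. c1 * \<bar>x\<bar> \<le> u x \<and> u x \<le> c2 * \<bar>x\<bar>)"
proof -
  obtain c where c: "0 < c" "\<forall>\<^sub>F x in nhds 0. c * \<bar>x\<bar> \<le> u x"
    using linear_lower_bound by blast
  obtain C where C: "C \<ge> 0" "C-lipschitz_on UNIV u"
    using lipschitz by blast
  \<comment> \<open>\<open>C\<close> is enlarged only to make the upper constant exceed the lower one.\<close>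
  have "u x \<le> (C + c + 1) * \<bar>x\<bar>" for x
  proof -
    have "u x \<le> C * \<bar>x\<bar>"
      using lipschitz_onD[OF C(2), of x 0] nonneg[of x] by (simp add: crest dist_real_def)
    also have "\<dots> \<le> (C + c + 1) * \<bar>x\<bar>"
      using c(1) by (intro mult_right_mono) auto
    finally show ?thesis .
  qed
  then show ?thesis
    using c C(1) by (intro exI[of _ c] exI[of _ "C + c + 1"]) auto
qed

lemma has_derivative_if_pos:
  assumes "u x > 0"
  shows "(u has_real_derivative g' x / (2 * u x)) (at x)"
proof -
  have "((\<lambda>x. sqrt ((u x)\<^sup>2)) has_real_derivative inverse (sqrt ((u x)\<^sup>2)) / 2 * g' x) (at x)"
    using assms by (intro DERIV_chain2[OF DERIV_real_sqrt deriv_sq]) auto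
  moreover have "(\<lambda>x. sqrt ((u x)\<^sup>2)) = u"
    using nonneg by simp
  ultimately show ?thesis
    using assms by (simp add: field_simps)
qed

text \<open>The first integral of the equation for \<open>u\<^sup>2\<close>. The constant of integration is fixed by continuity
  at the crest, where \<open>u\<close> and \<open>g'\<close> vanish although \<open>u\<close> need not be differentiable there.\<close>

lemma energy_identity:
  assumes "x < 0" and pos: "\<And>t. x < t \<Longrightarrow> t < 0 \<Longrightarrow> u t > 0"
  shows "(g' x)\<^sup>2 = 4 * (u x)\<^sup>2 * ((u x - \<mu>)\<^sup>2 - a)"
proof -
  define E where "E t = (g' t)\<^sup>2 - 4 * u t ^ 4 + 8 * \<mu> * u t ^ 3 - 4 * (\<mu>\<^sup>2 - a) * (u t)\<^sup>2" for t
  have "E 0 = E x"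
  proof (rule DERIV_isconst_end[OF assms(1)])
    have "isCont E t" for t
      unfolding E_def using DERIV_isCont[OF ode] by (intro continuous_intros continuous)
    then show "continuous_on {x..0} E"
      by (simp add: continuous_at_imp_continuous_on)
    fix t assume "x < t" "t < 0"
    then have u: "u t > 0" by (rule pos)
    note du = has_derivative_if_pos[OF u]
    have "(E has_real_derivative
        2 * g' t * (4 * (u t)\<^sup>2 - 6 * \<mu> * u t + 2 * (\<mu>\<^sup>2 - a))
        - (16 * u t ^ 3 - 24 * \<mu> * (u t)\<^sup>2 + 8 * (\<mu>\<^sup>2 - a) * u t) * (g' t / (2 * u t))) (at t)"
      unfolding E_def
      by (rule derivative_eq_intros ode du refl | simp add: algebra_simps power2_eq_square power3_eq_cube)+
    moreover have "2 * g' t * (4 * (u t)\<^sup>2 - 6 * \<mu> * u t + 2 * (\<mu>\<^sup>2 - a))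
        - (16 * u t ^ 3 - 24 * \<mu> * (u t)\<^sup>2 + 8 * (\<mu>\<^sup>2 - a) * u t) * (g' t / (2 * u t)) = 0"
      using u by (simp add: field_simps power2_eq_square power3_eq_cube)
    ultimately show "(E has_real_derivative 0) (at t)" by simp
  qed
  then have "E x = 0"
    by (simp add: E_def crest deriv_sq_zero)
  then show ?thesis
    unfolding E_def by algebra
qed

text \<open>By the energy identity all nonlinear terms cancel, leaving the linear equation \<open>u'' = u - \<mu>\<close>
  away from the crest.\<close>

lemma second_derivative_if_pos:
  assumes "x < 0" and pos: "\<And>t. x \<le> t \<Longrightarrow> t < 0 \<Longrightarrow> u t > 0"
  shows "((\<lambda>t. g' t / (2 * u t)) has_real_derivative u x - \<mu>) (at x)"
proof -
  have u: "u x > 0" using assms by simp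
  have "((\<lambda>t. g' t / (2 * u t)) has_real_derivative
      ((4 * (u x)\<^sup>2 - 6 * \<mu> * u x + 2 * (\<mu>\<^sup>2 - a)) * (2 * u x) - g' x * (2 * (g' x / (2 * u x))))
        / (2 * u x * (2 * u x))) (at x)"
    using u by (intro DERIV_divide ode DERIV_cmult has_derivative_if_pos) auto
  also have "g' x * (2 * (g' x / (2 * u x))) = (g' x)\<^sup>2 / u x"
    by (simp add: power2_eq_square)
  also have "\<dots> = 4 * u x * ((u x - \<mu>)\<^sup>2 - a)"
    using u assms by (subst energy_identity) (auto simp: power2_eq_square)
  also have "((4 * (u x)\<^sup>2 - 6 * \<mu> * u x + 2 * (\<mu>\<^sup>2 - a)) * (2 * u x) - 4 * u x * ((u x - \<mu>)\<^sup>2 - a))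
        / (2 * u x * (2 * u x)) = u x - \<mu>"
    using u by (simp add: field_simps power2_eq_square)
  finally show ?thesis .
qed

end

section \<open>From the nonlocal equation to the local one\<close>

text \<open>Regularity is gained in two steps: \<open>L\<close> of a bounded measurable function is continuous, and
  taking the root in \<open>(\<mu> - \<phi>)\<^sup>2 = \<mu>\<^sup>2 + 2a - 3 L(\<phi>\<^sup>2)\<close> passes this to \<open>\<phi>\<close>; with \<open>\<phi>\<^sup>2\<close>
  continuous, \<open>L(\<phi>\<^sup>2)\<close> has two derivatives. The bound \<open>\<phi> \<le> \<mu>\<close> selects the branch of the root.\<close>

lemma crested_profile_of_solution:
  assumes sol: "is_solution \<mu> a \<phi>" and le: "\<forall>x. \<phi> x \<le> \<mu>" and a: "a < \<mu>\<^sup>2" and crest: "\<phi> 0 = \<mu>"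
  obtains g' where "crested_profile \<mu> a (\<lambda>x. \<mu> - \<phi> x) g'"
proof -
  define f where "f y = (\<phi> y)\<^sup>2" for y
  have meas: "\<phi> \<in> borel_measurable lebesgue" and bdd: "bounded (range \<phi>)"
    and eq: "\<And>x. - \<mu> * \<phi> x + 1/2 * (\<phi> x)\<^sup>2 + 3/2 * op_L f x = a"
    using sol by (auto simp: is_solution_def f_def[abs_def])
  obtain B where B: "\<And>x. \<bar>\<phi> x\<bar> \<le> B"
    using bdd by (auto simp: bounded_iff)
  have "norm (f x) \<le> B\<^sup>2" for x
    using power_mono[OF B[of x], of 2] by (simp add: f_def)
  then have f_bdd: "bounded (range f)"
    by (auto simp: bounded_iff)
  have f_meas: "f \<in> borel_measurable lebesgue"
    unfolding f_def using meas by measurable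
  have sq: "(\<mu> - \<phi> x)\<^sup>2 = \<mu>\<^sup>2 + 2 * a - 3 * op_L f x" for x
    using eq[of x] by (simp add: power2_eq_square algebra_simps)
  have phi_eq: "\<phi> = (\<lambda>x. \<mu> - sqrt (\<mu>\<^sup>2 + 2 * a - 3 * op_L f x))"
    using le by (auto simp flip: sq)
  have "continuous_on UNIV \<phi>"
    by (subst phi_eq) (intro continuous_intros continuous_op_L f_meas f_bdd)
  then have f_cont: "continuous_on UNIV f"
    unfolding f_def by (intro continuous_intros)
  obtain w' where w': "\<And>x. (op_L f has_real_derivative w' x) (at x)"
      "\<And>x. (w' has_real_derivative op_L f x - f x) (at x)"
    using op_L_second_derivative[OF f_cont f_bdd] by blast
  have "crested_profile \<mu> a (\<lambda>x. \<mu> - \<phi> x) (\<lambda>x. - 3 * w' x)"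
  proof
    have "norm (\<mu> - \<phi> x) \<le> \<bar>\<mu>\<bar> + B" for x
      using B[of x] by simp
    then show "bounded (range (\<lambda>x. \<mu> - \<phi> x))"
      by (auto simp: bounded_iff)
    fix x
    show "((\<lambda>x. (\<mu> - \<phi> x)\<^sup>2) has_real_derivative - 3 * w' x) (at x)"
      unfolding sq by (auto intro!: derivative_eq_intros w')
    have "((\<lambda>x. - 3 * w' x) has_real_derivative - 3 * (op_L f x - f x)) (at x)"
      by (auto intro!: derivative_eq_intros w')
    moreover have "- 3 * (op_L f x - f x) = 4 * (\<mu> - \<phi> x)\<^sup>2 - 6 * \<mu> * (\<mu> - \<phi> x) + 2 * (\<mu>\<^sup>2 - a)"
      using eq[of x] by (simp add: f_def power2_eq_square algebra_simps)
    ultimately show "((\<lambda>x. - 3 * w' x) has_real_derivative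
        4 * (\<mu> - \<phi> x)\<^sup>2 - 6 * \<mu> * (\<mu> - \<phi> x) + 2 * (\<mu>\<^sup>2 - a)) (at x)"
      by simp
  qed (use le a crest in auto)
  then show thesis by (rule that)
qed

section \<open>Absence of further crests\<close>

text \<open>Monotonicity carries the strict inequality, known close to the crest by linear growth, to the
  rest of the half-period.\<close>

lemma below_crest_on_half_period:
  fixes \<phi> :: "real \<Rightarrow> real"
  assumes mono: "mono_on (einterval (- R) 0) \<phi>"
    and le: "\<And>x. \<phi> x \<le> \<mu>"
    and lower: "c > 0" "\<forall>\<^sub>F x in nhds 0. c * \<bar>x\<bar> \<le> \<mu> - \<phi> x"
    and x: "x \<in> einterval (- R) 0"
  shows "\<phi> x < \<mu>"
proof -
  obtain d where d: "d > 0" "\<And>y. \<bar>y\<bar> < d \<Longrightarrow> c * \<bar>y\<bar> \<le> \<mu> - \<phi> y"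
    using lower(2) by (auto simp: eventually_nhds_metric)
  have xR: "- R < ereal x" "x < 0"
    using x by (auto simp: einterval_def)
  define y where "y = max x (- d / 2)"
  have y: "x \<le> y" "y < 0" "\<bar>y\<bar> < d"
    using d(1) xR by (auto simp: y_def)
  then have "y \<in> einterval (- R) 0"
    using xR less_le_trans[of "- R" "ereal x" "ereal y"] by (auto simp: einterval_def)
  then have "\<phi> x \<le> \<phi> y"
    using mono x y(1) by (auto simp: mono_on_def)
  moreover have "0 < c * \<bar>y\<bar>"
    using lower(1) y(2) by (intro mult_pos_pos) auto
  ultimately show ?thesis
    using d(2)[OF y(3)] by simp
qed

text \<open>Evenness and periodicity reflect the half-period about its left end \<open>- P/2\<close>. The end itself lies
  outside the interval of monotonicity and is reached by continuity.\<close>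

lemma below_crest_on_period:
  fixes \<phi> :: "real \<Rightarrow> real"
  assumes per: "periodic_ext P \<phi>" and P: "0 < P" and even: "\<And>x. \<phi> (- x) = \<phi> x"
    and cont: "\<And>x. isCont \<phi> x"
    and mono: "mono_on (einterval (- (P / 2)) 0) \<phi>"
    and less: "\<And>x. x \<in> einterval (- (P / 2)) 0 \<Longrightarrow> \<phi> x < \<mu>"
    and x: "x \<in> einterval (- P) 0"
  shows "\<phi> x < \<mu>"
proof (cases P)
  case (real p)
  have p: "p > 0" and x': "- p < x" "x < 0"
    using P x by (auto simp: real einterval_def)
  have half: "einterval (- (P / 2)) 0 = {- p / 2<..<0}"
    by (auto simp: real einterval_def)
  have shift: "\<phi> (y + p) = \<phi> y" for y
    using per by (auto simp: periodic_ext_def real)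
  consider "x > - p / 2" | "x = - p / 2" | "x < - p / 2" by linarith
  then show ?thesis
  proof cases
    case 1
    then show ?thesis using x' by (intro less) (unfold half, simp)
  next
    case 2
    have "(\<phi> \<longlongrightarrow> \<phi> x) (at_right x)"
      using cont[of x] by (simp add: isCont_def filterlim_at_split)
    moreover have "\<forall>\<^sub>F y in at_right x. \<phi> y \<le> \<phi> (- p / 4)"
    proof -
      have "\<forall>\<^sub>F y in at_right x. y \<in> {x<..<- p / 4}"
        using p by (intro eventually_at_right_real) (simp add: 2)
      then show ?thesis
      proof eventually_elim
        case (elim y)
        then show ?case
          using p 2 by (intro mono_onD[OF mono]) (unfold half, auto)
      qed
    qed
    ultimately have "\<phi> x \<le> \<phi> (- p / 4)"
      by (intro tendsto_upperbound) auto
    also have "\<dots> < \<mu>"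
      using p by (intro less) (unfold half, simp)
    finally show ?thesis .
  next
    case 3
    have "\<phi> (- x - p) < \<mu>"
      using 3 x' by (intro less) (unfold half, auto)
    then show ?thesis
      using shift[of "- x - p"] even[of x] by simp
  qed
next
  case PInf
  then show ?thesis using x by (intro less) simp
qed (use P in simp)

section \<open>Regularity of the crested wave\<close>

theorem theorem3p5:
  fixes \<mu> a :: real and P :: ereal and \<phi> :: "real \<Rightarrow> real"
  assumes "\<mu> > 0"
    and "- (\<mu>\<^sup>2 / 8) < a" and "a < \<mu>\<^sup>2"
    and "0 < P"
    and "periodic_ext P \<phi>"
    and "is_solution \<mu> a \<phi>"
    and "\<forall>x. \<phi> x \<le> \<mu>"
    and "\<forall>x. \<phi> (- x) = \<phi> x"
    and "\<not> \<phi> constant_on UNIV"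
    and "mono_on (einterval (- (P / 2)) 0) \<phi>"
    and "\<phi> 0 = \<mu>"
  shows "smooth_on_open (einterval (- P) 0) \<phi>
    \<and> (\<exists>C. C-lipschitz_on UNIV \<phi>)
    \<and> (\<exists>c1 c2. 0 < c1 \<and> c1 < c2 \<and>
         (\<forall>\<^sub>F x in nhds 0. c1 * \<bar>x\<bar> \<le> \<bar>\<mu> - \<phi> x\<bar> \<and> \<bar>\<mu> - \<phi> x\<bar> \<le> c2 * \<bar>x\<bar>))"
proof -
  obtain g' where "crested_profile \<mu> a (\<lambda>x. \<mu> - \<phi> x) g'"
    using crested_profile_of_solution assms by blast
  then interpret crested_profile \<mu> a "\<lambda>x. \<mu> - \<phi> x" g' .
  let ?S = "einterval (- P) 0"
  have phi_eq: "\<phi> = (\<lambda>x. \<mu> - (\<mu> - \<phi> x))" by simp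
  have cont: "isCont \<phi> x" for x
    by (subst phi_eq) (intro continuous_intros continuous)
  obtain c where c: "0 < c" "\<forall>\<^sub>F x in nhds 0. c * \<bar>x\<bar> \<le> \<mu> - \<phi> x"
    using linear_lower_bound by blast
  have half: "\<phi> x < \<mu>" if "x \<in> einterval (- (P / 2)) 0" for x
    by (rule below_crest_on_half_period[OF assms(10) _ c that]) (use assms(7) in blast)
  have below: "\<phi> x < \<mu>" if "x \<in> ?S" for x
    by (rule below_crest_on_period[OF assms(5,4) _ cont assms(10) half that]) (use assms(8) in blast)
  have pos: "\<mu> - \<phi> t > 0" if "x \<in> ?S" "x \<le> t" "t < 0" for x t
  proof -
    have "t \<in> ?S"
      using that less_le_trans[of "- P" "ereal x" "ereal t"] by (auto simp: einterval_def)
    then show ?thesis using below by simp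
  qed
  have smooth: "smooth_on_open ?S \<phi>"
  proof (rule smooth_on_open_if_second_deriv_eq_self)
    fix x assume x: "x \<in> ?S"
    then have "x < 0" by (simp add: einterval_def)
    have d: "((\<lambda>x. \<mu> - \<phi> x) has_real_derivative g' x / (2 * (\<mu> - \<phi> x))) (at x)"
      using has_derivative_if_pos below[OF x] by simp
    then have "((\<lambda>x. \<mu> - (\<mu> - \<phi> x)) has_real_derivative 0 - g' x / (2 * (\<mu> - \<phi> x))) (at x)"
      by (intro DERIV_diff DERIV_const)
    then show "(\<phi> has_real_derivative - (g' x / (2 * (\<mu> - \<phi> x)))) (at x)"
      by simp
    have "((\<lambda>t. g' t / (2 * (\<mu> - \<phi> t))) has_real_derivative (\<mu> - \<phi> x) - \<mu>) (at x)"
      using second_derivative_if_pos[OF \<open>x < 0\<close> pos[OF x]] .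
    then show "((\<lambda>t. - (g' t / (2 * (\<mu> - \<phi> t)))) has_real_derivative \<phi> x) (at x)"
      using DERIV_minus by fastforce
  qed simp
  obtain C where C: "C-lipschitz_on UNIV (\<lambda>x. \<mu> - \<phi> x)"
    using lipschitz by blast
  have "C-lipschitz_on UNIV \<phi>"
  proof (rule lipschitz_onI)
    fix x y
    show "dist (\<phi> x) (\<phi> y) \<le> C * dist x y"
      using lipschitz_onD[OF C, of x y] by (simp add: dist_real_def abs_minus_commute)
  qed (rule lipschitz_on_nonneg[OF C])
  moreover have "\<bar>\<mu> - \<phi> x\<bar> = \<mu> - \<phi> x" for x
    using nonneg[of x] by simp
  ultimately show ?thesis
    using smooth exactly_lipschitz_at_crest by auto
qed

end
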